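(* Let $G$ be a finite circuit-free directed graph, with set of vertices $G_0$ and set of edges $G_1$, and let $F(G)$ be the free category on $G$. Then $\chi(F(G))$ is defined and equal to $|G_0| - |G_1|$.
   Context: A directed graph $G = (G_1 \rightrightarrows G_0)$ (multiple edges allowed) is circuit-free if it contains no circuits of non-zero length, i.e. no directed path of length $n \geq 1$ starting and ending at the same vertex. The free category $F(G)$ has the vertices as objects and the directed paths (of length $\geq 0$) as arrows; it is finite when $G$ is finite and circuit-free. For a finite category $\mathbb{A}$, a weighting on $\mathbb{A}$ is a function $k^\bullet: \mathrm{ob}\,\mathbb{A} \to \mathbb{Q}$ such that $\sum_{b} |\mathbb{A}(a,b)|\, k^b = 1$ for all $a \in \mathbb{A}$. A coweighting $k_\bullet$ on $\mathbb{A}$ is a weighting on $\mathbb{A}^{\mathrm{op}}$. A finite category $\mathbb{A}$ has Euler characteristic ($\chi(\mathbb{A})$ is defined) if it admits both a weighting and a coweighting; then $\chi(\mathbb{A}) = \sum_a k^a = \sum_a k_a \in \mathbb{Q}$ for any weighting $k^\bullet$ and coweighting $k_\bullet$ (the two sums agree and do not depend on the choices). *)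

theory Defs
  imports Complex_Main "Graph_Theory.Arc_Walk"
begin

section \<open>Finite categories\<close>

text \<open>
  Composition is written in applicative order: \<open>cmp C g f\<close> is "g after f" and is only
  meaningful when \<open>tgt C f = src C g\<close>.
\<close>

record ('o, 'm) cat =
  obs :: "'o set"
  arrs :: "'m set"
  src :: "'m \<Rightarrow> 'o"
  tgt :: "'m \<Rightarrow> 'o"
  idn :: "'o \<Rightarrow> 'm"
  cmp :: "'m \<Rightarrow> 'm \<Rightarrow> 'm"

definition hom_set :: "('o, 'm) cat \<Rightarrow> 'o \<Rightarrow> 'o \<Rightarrow> 'm set" where
  "hom_set C a b = {f \<in> arrs C. src C f = a \<and> tgt C f = b}"

locale category =
  fixes C :: "('o, 'm) cat"
  assumes src_in_obs: "f \<in> arrs C \<Longrightarrow> src C f \<in> obs C"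
    and tgt_in_obs: "f \<in> arrs C \<Longrightarrow> tgt C f \<in> obs C"
    and idn_in_hom: "a \<in> obs C \<Longrightarrow> idn C a \<in> hom_set C a a"
    and cmp_in_hom: "\<lbrakk>f \<in> hom_set C a b; g \<in> hom_set C b c\<rbrakk> \<Longrightarrow> cmp C g f \<in> hom_set C a c"
    and cmp_idn_right: "f \<in> hom_set C a b \<Longrightarrow> cmp C f (idn C a) = f"
    and cmp_idn_left: "f \<in> hom_set C a b \<Longrightarrow> cmp C (idn C b) f = f"
    and cmp_assoc: "\<lbrakk>f \<in> hom_set C a b; g \<in> hom_set C b c; h \<in> hom_set C c d\<rbrakk>
      \<Longrightarrow> cmp C h (cmp C g f) = cmp C (cmp C h g) f"

locale finite_category = category +
  assumes finite_obs: "finite (obs C)"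
    and finite_arrs: "finite (arrs C)"

definition op_cat :: "('o, 'm) cat \<Rightarrow> ('o, 'm) cat" where
  "op_cat C = \<lparr>obs = obs C, arrs = arrs C, src = tgt C, tgt = src C,
     idn = idn C, cmp = (\<lambda>g f. cmp C f g)\<rparr>"

section \<open>Euler characteristic\<close>

text \<open>Only the values of \<open>k\<close> on \<open>obs C\<close> are relevant.\<close>

definition weighting :: "('o, 'm) cat \<Rightarrow> ('o \<Rightarrow> rat) \<Rightarrow> bool" where
  "weighting C k \<longleftrightarrow> (\<forall>a \<in> obs C. (\<Sum>b \<in> obs C. of_nat (card (hom_set C a b)) * k b) = 1)"

definition coweighting :: "('o, 'm) cat \<Rightarrow> ('o \<Rightarrow> rat) \<Rightarrow> bool" where
  "coweighting C k \<longleftrightarrow> weighting (op_cat C) k"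

definition has_euler_char :: "('o, 'm) cat \<Rightarrow> bool" where
  "has_euler_char C \<longleftrightarrow>
     finite_category C \<and> (\<exists>k. weighting C k) \<and> (\<exists>l. coweighting C l)"

text \<open>
  Meaningful only under \<open>has_euler_char C\<close>; the two lemmas below show that the common value
  then exists and is unique.
\<close>

definition euler_char :: "('o, 'm) cat \<Rightarrow> rat" where
  "euler_char C = (THE x. \<forall>k l. weighting C k \<longrightarrow> coweighting C l \<longrightarrow>
     (\<Sum>a \<in> obs C. k a) = x \<and> (\<Sum>a \<in> obs C. l a) = x)"

lemma hom_set_op_cat: "hom_set (op_cat C) a b = hom_set C b a"
  by (auto simp: hom_set_def op_cat_def)

lemma sum_weighting_eq_sum_coweighting:
  assumes "weighting C k" and "coweighting C l"
  shows "(\<Sum>a \<in> obs C. k a) = (\<Sum>a \<in> obs C. l a)"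
proof -
  have l: "(\<Sum>a \<in> obs C. of_nat (card (hom_set C a b)) * l a) = 1" if "b \<in> obs C" for b
    using assms(2) that
    by (simp add: coweighting_def weighting_def hom_set_op_cat) (simp add: op_cat_def)
  have k: "(\<Sum>b \<in> obs C. of_nat (card (hom_set C a b)) * k b) = 1" if "a \<in> obs C" for a
    using assms(1) that by (simp add: weighting_def)
  have "(\<Sum>b \<in> obs C. k b)
      = (\<Sum>b \<in> obs C. (\<Sum>a \<in> obs C. of_nat (card (hom_set C a b)) * l a) * k b)"
    by (intro sum.cong refl) (simp add: l)
  also have "\<dots> = (\<Sum>b \<in> obs C. \<Sum>a \<in> obs C. l a * (of_nat (card (hom_set C a b)) * k b))"
    by (simp add: sum_distrib_left sum_distrib_right mult_ac)
  also have "\<dots> = (\<Sum>a \<in> obs C. \<Sum>b \<in> obs C. l a * (of_nat (card (hom_set C a b)) * k b))"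
    by (rule sum.swap)
  also have "\<dots> = (\<Sum>a \<in> obs C. l a * (\<Sum>b \<in> obs C. of_nat (card (hom_set C a b)) * k b))"
    by (simp add: sum_distrib_left)
  also have "\<dots> = (\<Sum>a \<in> obs C. l a)"
    by (intro sum.cong refl) (simp add: k)
  finally show ?thesis .
qed

lemma euler_char_eq:
  assumes "weighting C k" and "coweighting C l"
  shows "euler_char C = (\<Sum>a \<in> obs C. k a)" and "euler_char C = (\<Sum>a \<in> obs C. l a)"
proof -
  show *: "euler_char C = (\<Sum>a \<in> obs C. k a)"
    unfolding euler_char_def
  proof (rule the_equality)
    show "\<forall>k' l'. weighting C k' \<longrightarrow> coweighting C l' \<longrightarrow>
        (\<Sum>a \<in> obs C. k' a) = (\<Sum>a \<in> obs C. k a) \<and> (\<Sum>a \<in> obs C. l' a) = (\<Sum>a \<in> obs C. k a)"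
      using assms sum_weighting_eq_sum_coweighting by metis
  qed (use assms in blast)
  then show "euler_char C = (\<Sum>a \<in> obs C. l a)"
    using sum_weighting_eq_sum_coweighting[OF assms] by simp
qed

section \<open>The free category on a directed graph\<close>

text \<open>
  A \<open>pre_digraph\<close> satisfying \<open>wf_digraph\<close> allows loops and multiple arcs. A path from \<open>u\<close> to
  \<open>v\<close> is an arc walk \<open>awalk u p v\<close>, which may be empty and may repeat vertices and arcs.
\<close>

definition circuit_free :: "('a, 'b) pre_digraph \<Rightarrow> bool" where
  "circuit_free G \<longleftrightarrow> \<not> (\<exists>u p. pre_digraph.awalk G u p u \<and> length p \<ge> 1)"

text \<open>
  An arrow carries its endpoints explicitly, since the empty list of arcs alone does not
  determine at which vertex the path of length zero sits.
\<close>

definition free_category :: "('a, 'b) pre_digraph \<Rightarrow> ('a, 'a \<times> 'b list \<times> 'a) cat" where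
  "free_category G =
     \<lparr>obs = verts G,
      arrs = {(u, p, v). pre_digraph.awalk G u p v},
      src = (\<lambda>(u, p, v). u),
      tgt = (\<lambda>(u, p, v). v),
      idn = (\<lambda>u. (u, [], u)),
      cmp = (\<lambda>(v, q, w) (u, p, v'). (u, p @ q, w))\<rparr>"

lemma category_free_category:
  assumes "wf_digraph G"
  shows "category (free_category G)"
proof -
  interpret wf_digraph G by fact
  show ?thesis
    by unfold_locales
      (auto simp: free_category_def hom_set_def awalk_Nil_iff
        dest: awalk_hd_in_verts awalk_last_in_verts)
qed

end

theory Submission
  imports Defs
begin

text \<open>
  A path of nonzero length starting at \<open>a\<close> is, in exactly one way, a path from \<open>a\<close> to some
  vertex \<open>b\<close> followed by an arc leaving \<open>b\<close>. Writing \<open>h a b\<close> for the number of paths from \<open>a\<close>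
  to \<open>b\<close>, and counting the empty path separately, this says
  \<open>(\<Sum>b. h a b) = 1 + (\<Sum>b. h a b * out_degree b)\<close>, that is,
  \<open>(\<Sum>b. h a b * (1 - out_degree b)) = 1\<close>. So \<open>1 - out_degree\<close> is a weighting on the free
  category (\<open>out_degree_weighting\<close>). Splitting off the first arc instead of the last shows that
  \<open>1 - in_degree\<close> is a coweighting (\<open>in_degree_coweighting\<close>). The total of the weighting is the
  number of vertices minus the sum of the out-degrees, and every arc is counted in exactly one
  out-degree.

  Absence of circuits is what makes these counts finite: a path that repeats a vertex contains a
  circuit, so all paths have distinct vertices, and a finite graph has finitely many of those.
\<close>

lemma (in wf_digraph) circuit_free_awalk_imp_apath:
  assumes "circuit_free G" and "awalk u p v"
  shows "apath u p v"
proof -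
  have "distinct (awalk_verts u p)"
  proof (rule ccontr)
    assume "\<not> distinct (awalk_verts u p)"
    then obtain r w where "awalk w r w" "0 < length r"
      using awalk_not_distinct_decomp[OF assms(2)] by blast
    with assms(1) show False
      by (auto simp: circuit_free_def Suc_le_eq)
  qed
  with assms(2) show ?thesis by (simp add: apath_def)
qed

lemma (in fin_digraph) finite_awalks:
  assumes "circuit_free G"
  shows "finite {p. awalk u p v}"
  using circuit_free_awalk_imp_apath[OF assms]
  by (auto intro: finite_subset[OF _ apaths_finite])

lemma (in fin_digraph) finite_category_free_category:
  assumes "circuit_free G"
  shows "finite_category (free_category G)"
proof -
  interpret category "free_category G"
    by (rule category_free_category) unfold_locales
  have "{(u, p, v). awalk u p v} \<subseteq> {(u, p, v). apath u p v}"
    using circuit_free_awalk_imp_apath[OF assms] by auto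
  then have "finite {(u, p, v). awalk u p v}"
    using apaths_finite_triple by (rule finite_subset)
  then show ?thesis
    by unfold_locales (simp_all add: free_category_def)
qed

lemma card_hom_set_free_category:
  "card (hom_set (free_category G) a b) = card {p. pre_digraph.awalk G a p b}"
proof -
  have "hom_set (free_category G) a b = (\<lambda>p. (a, p, b)) ` {p. pre_digraph.awalk G a p b}"
    by (auto simp: hom_set_def free_category_def)
  then show ?thesis by (simp add: card_image inj_on_def)
qed

text \<open>
  Appending an arc is a bijection from pairs of a path out of \<open>a\<close> and an arc that continues it,
  onto the nonempty paths out of \<open>a\<close>. In both the paths are indexed by their end vertex, which the
  bijection moves from the tail to the head of the new arc.
\<close>

lemma (in fin_digraph) card_awalks_split_last:
  assumes cf: "circuit_free G" and a: "a \<in> verts G"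
  shows "(\<Sum>b \<in> verts G. card {p. awalk a p b})
    = Suc (\<Sum>b \<in> verts G. card {p. awalk a p b} * out_degree G b)"
proof -
  let ?paths = "SIGMA b : verts G. {p. awalk a p b}"
  let ?split = "SIGMA b : verts G. {p. awalk a p b} \<times> out_arcs G b"
  let ?append = "\<lambda>(b, p, e). (head G e, p @ [e])"
  have empty: "(a, []) \<in> ?paths" using a by (simp add: awalk_Nil_iff)
  have image: "?append ` ?split = ?paths - {(a, [])}"
  proof (intro equalityI subsetI)
    fix x assume "x \<in> ?append ` ?split"
    then show "x \<in> ?paths - {(a, [])}"
      by (auto simp: awalk_simps)
  next
    fix x assume x: "x \<in> ?paths - {(a, [])}"
    obtain b q where q_eq: "x = (b, q)" by (cases x)
    with x have walk: "awalk a q b" by simp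
    with x q_eq have "q \<noteq> []" by (auto simp: awalk_Nil_iff)
    note q = q_eq walk this
    then obtain p e where "q = p @ [e]" by (metis rev_exhaust)
    with q have "awalk a p (tail G e)" "e \<in> arcs G" "b = head G e"
      by (auto simp: awalk_simps)
    with \<open>q = p @ [e]\<close> q(1) have "(tail G e, p, e) \<in> ?split" "x = ?append (tail G e, p, e)"
      by auto
    then show "x \<in> ?append ` ?split" by blast
  qed
  have "inj_on ?append ?split"
    by (auto simp: inj_on_def)
  from card_image[OF this] have "card ?split = card (?paths - {(a, [])})"
    unfolding image by (rule sym)
  moreover have "finite ?paths"
    using finite_awalks[OF cf] by simp
  ultimately have "card ?paths = Suc (card ?split)"
    using card_Suc_Diff1[OF _ empty] by simp
  then show ?thesis
    using finite_awalks[OF cf]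
    by (simp add: card_SigmaI card_cartesian_product out_degree_def finite_out_arcs)
qed

lemma (in fin_digraph) card_awalks_split_first:
  assumes cf: "circuit_free G" and b: "b \<in> verts G"
  shows "(\<Sum>a \<in> verts G. card {p. awalk a p b})
    = Suc (\<Sum>a \<in> verts G. card {p. awalk a p b} * in_degree G a)"
proof -
  let ?paths = "SIGMA a : verts G. {p. awalk a p b}"
  let ?split = "SIGMA a : verts G. {p. awalk a p b} \<times> in_arcs G a"
  let ?prepend = "\<lambda>(a, p, e). (tail G e, e # p)"
  have empty: "(b, []) \<in> ?paths" using b by (simp add: awalk_Nil_iff)
  have image: "?prepend ` ?split = ?paths - {(b, [])}"
  proof (intro equalityI subsetI)
    fix x assume "x \<in> ?prepend ` ?split"
    then show "x \<in> ?paths - {(b, [])}"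
      by (auto simp: awalk_simps)
  next
    fix x assume x: "x \<in> ?paths - {(b, [])}"
    obtain a q where q_eq: "x = (a, q)" by (cases x)
    with x have walk: "awalk a q b" by simp
    with x q_eq have "q \<noteq> []" by (auto simp: awalk_Nil_iff)
    note q = q_eq walk this
    then obtain e p where "q = e # p" by (metis list.exhaust)
    with q have "awalk (head G e) p b" "e \<in> arcs G" "a = tail G e"
      by (auto simp: awalk_simps)
    with \<open>q = e # p\<close> q(1) have "(head G e, p, e) \<in> ?split" "x = ?prepend (head G e, p, e)"
      by auto
    then show "x \<in> ?prepend ` ?split" by blast
  qed
  have "inj_on ?prepend ?split"
    by (auto simp: inj_on_def)
  from card_image[OF this] have "card ?split = card (?paths - {(b, [])})"
    unfolding image by (rule sym)
  moreover have "finite ?paths"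
    using finite_awalks[OF cf] by simp
  ultimately have "card ?paths = Suc (card ?split)"
    using card_Suc_Diff1[OF _ empty] by simp
  then show ?thesis
    using finite_awalks[OF cf]
    by (simp add: card_SigmaI card_cartesian_product in_degree_def finite_in_arcs)
qed

lemma weighted_sum_one_minus:
  fixes h d :: "'a \<Rightarrow> nat"
  assumes "(\<Sum>b \<in> A. h b) = Suc (\<Sum>b \<in> A. h b * d b)"
  shows "(\<Sum>b \<in> A. of_nat (h b) * (1 - of_nat (d b))) = (1 :: rat)"
proof -
  have "(\<Sum>b \<in> A. of_nat (h b) * (1 - of_nat (d b)))
      = (of_nat (\<Sum>b \<in> A. h b) - of_nat (\<Sum>b \<in> A. h b * d b) :: rat)"
    by (simp add: right_diff_distrib sum_subtractf)
  then show ?thesis by (simp only: assms)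
qed

lemma (in fin_digraph) out_degree_weighting:
  assumes "circuit_free G"
  shows "weighting (free_category G) (\<lambda>b. 1 - of_nat (out_degree G b))"
  unfolding weighting_def card_hom_set_free_category
  by (auto simp: free_category_def
      intro: weighted_sum_one_minus card_awalks_split_last[OF assms])

lemma (in fin_digraph) in_degree_coweighting:
  assumes "circuit_free G"
  shows "coweighting (free_category G) (\<lambda>a. 1 - of_nat (in_degree G a))"
  unfolding coweighting_def weighting_def hom_set_op_cat card_hom_set_free_category
  by (auto simp: op_cat_def free_category_def
      intro: weighted_sum_one_minus card_awalks_split_first[OF assms])

lemma (in fin_digraph) sum_out_degree:
  "(\<Sum>v \<in> verts G. out_degree G v) = card (arcs G)"
proof -
  have "arcs G = (\<Union>v \<in> verts G. out_arcs G v)"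
    by auto
  moreover have "card (\<Union>v \<in> verts G. out_arcs G v) = (\<Sum>v \<in> verts G. card (out_arcs G v))"
    by (rule card_UN_disjoint) auto
  ultimately show ?thesis by (simp add: out_degree_def)
qed

theorem proposition2p10:
  fixes G :: "('a, 'b) pre_digraph"
  assumes "fin_digraph G"
    and "circuit_free G"
  shows "has_euler_char (free_category G) \<and>
    euler_char (free_category G) = of_nat (card (verts G)) - of_nat (card (arcs G))"
proof -
  interpret fin_digraph G by fact
  note w = out_degree_weighting[OF assms(2)] and cw = in_degree_coweighting[OF assms(2)]
  have "has_euler_char (free_category G)"
    unfolding has_euler_char_def
    using finite_category_free_category[OF assms(2)] w cw by blast
  moreover have "euler_char (free_category G) = (\<Sum>v \<in> verts G. 1 - of_nat (out_degree G v))"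
    using euler_char_eq(1)[OF w cw] by (simp add: free_category_def)
  then have "euler_char (free_category G) = of_nat (card (verts G)) - of_nat (card (arcs G))"
    by (simp add: sum_subtractf flip: sum_out_degree)
  ultimately show ?thesis by blast
qed

end
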